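(* Let $m,d$ be positive integers with $m>2d$. For a ballot sequence $\beta=\beta_1\beta_2\ldots\beta_{m-1}\in\mathcal{B}_{m-d,d-1}$ put $$\eta(\beta)=\{i\mid \beta_i=Y\}\uplus\{m\}.$$ Then $\eta$ is a well-defined bijection $\eta:\mathcal{B}_{m-d,d-1}\to\mathfrak{P}(m,d)$.
   Context: For a permutation $\pi=\pi_1\ldots\pi_n$ of $[n]=\{1,\dots,n\}$ in one-line notation, its pinnacle set is $\operatorname{Pin}\pi=\{\pi_i\mid 2\le i\le n-1,\ \pi_{i-1}<\pi_i>\pi_{i+1}\}$. A set $S$ is an admissible pinnacle set (admissible) if $S=\operatorname{Pin}\pi$ for some permutation $\pi$ (of some $[n]$). $\mathfrak{P}(m,d)$ is the set of admissible $S$ with $\max S=m$ and $\#S=d$. For nonnegative integers $p>q$, a $(p,q)$ ballot sequence is a sequence $\beta=\beta_1\beta_2\ldots\beta_{p+q}$ consisting of $p$ copies of the letter $X$ and $q$ copies of the letter $Y$ such that in every nonempty prefix $\beta_1\ldots\beta_i$ the number of $X$'s is strictly greater than the number of $Y$'s. $\mathcal{B}_{p,q}$ is the set of $(p,q)$ ballot sequences. The symbol $\uplus$ denotes disjoint union. *)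

theory Defs
  imports "HOL-Combinatorics.Permutations"
begin

text \<open>A permutation of \<open>[n]\<close> in one-line notation \<open>\<pi>\<^sub>1 \<dots> \<pi>\<^sub>n\<close> is a function \<open>\<pi>\<close>
  with \<open>\<pi> permutes {1..n}\<close>, where \<open>\<pi>\<^sub>i = \<pi> i\<close>.\<close>

definition Pin :: "nat \<Rightarrow> (nat \<Rightarrow> nat) \<Rightarrow> nat set" where
  "Pin n \<pi> = {\<pi> i |i. 2 \<le> i \<and> i \<le> n - 1 \<and> \<pi> (i - 1) < \<pi> i \<and> \<pi> i > \<pi> (i + 1)}"

definition admissible :: "nat set \<Rightarrow> bool" where
  "admissible S \<longleftrightarrow> (\<exists>n \<pi>. \<pi> permutes {1..n} \<and> S = Pin n \<pi>)"

text \<open>\<open>Max {}\<close> is an unspecified value in HOL, so nonemptiness is explicit.\<close>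

definition pinnacle_sets :: "nat \<Rightarrow> nat \<Rightarrow> nat set set" where
  "pinnacle_sets m d = {S. admissible S \<and> S \<noteq> {} \<and> Max S = m \<and> card S = d}"

datatype letter = X | Y

definition ballot_sequences :: "nat \<Rightarrow> nat \<Rightarrow> letter list set" where
  "ballot_sequences p q =
     {\<beta>. length \<beta> = p + q \<and> count_list \<beta> X = p \<and> count_list \<beta> Y = q \<and>
         (\<forall>i\<in>{1..p + q}. count_list (take i \<beta>) X > count_list (take i \<beta>) Y)}"

text \<open>Lists are indexed from \<open>0\<close>, so \<open>\<beta>\<^sub>i\<close> is \<open>\<beta> ! (i - 1)\<close>.\<close>

definition Y_positions :: "letter list \<Rightarrow> nat set" where
  "Y_positions \<beta> = {i \<in> {1..length \<beta>}. \<beta> ! (i - 1) = Y}"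

definition eta :: "nat \<Rightarrow> letter list \<Rightarrow> nat set" where
  "eta m \<beta> = Y_positions \<beta> \<union> {m}"

end

theory Submission
  imports Defs
begin

text \<open>A set \<open>S = {s\<^sub>1 < \<dots> < s\<^sub>d}\<close> is admissible iff \<open>2 i < s\<^sub>i\<close> for all \<open>i\<close>. For necessity, the
  \<open>i\<close> pinnacles of height at most \<open>s\<^sub>i\<close> occupy pairwise non-adjacent positions, so together with
  their neighbours they give at least \<open>2 i + 1\<close> distinct values in \<open>{1..s\<^sub>i}\<close>. For sufficiency, let
  \<open>c\<^sub>1 < c\<^sub>2 < \<dots>\<close> be the non-elements of \<open>S\<close>; then \<open>c\<^sub>1 s\<^sub>1 c\<^sub>2 s\<^sub>2 \<dots> c\<^sub>d s\<^sub>d c\<^sub>d\<^sub>+\<^sub>1 c\<^sub>d\<^sub>+\<^sub>2 \<dots>\<close> has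
  pinnacle set \<open>S\<close>. The ballot condition says \<open>2 \<bar>T \<inter> {1..i}\<bar> < i\<close> for the set \<open>T\<close> of \<open>Y\<close>-positions
  and all \<open>i\<close>; it is enough to require this for \<open>i \<in> T\<close>, which is the same criterion.\<close>

section \<open>Necessity: counting the values below a pinnacle\<close>

lemma Pin_subset:
  assumes "\<pi> permutes {1..n}"
  shows "Pin n \<pi> \<subseteq> {1..n}"
proof
  fix x assume "x \<in> Pin n \<pi>"
  then obtain i where "x = \<pi> i" "2 \<le> i" "i \<le> n - 1" by (auto simp: Pin_def)
  then show "x \<in> {1..n}" using permutes_in_image[OF assms, of i] by auto
qed

lemma card_Pin_le:
  assumes perm: "\<pi> permutes {1..n}" and s: "s \<in> Pin n \<pi>"
  shows "2 * card (Pin n \<pi> \<inter> {..s}) < s"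
proof -
  define P where "P = {i. 2 \<le> i \<and> i \<le> n - 1 \<and> \<pi> (i - 1) < \<pi> i \<and> \<pi> (i + 1) < \<pi> i \<and> \<pi> i \<le> s}"
  have inj: "inj \<pi>" using perm by (rule permutes_inj)
  have fin: "finite P" by (rule finite_subset[of _ "{..n}"]) (auto simp: P_def)
  have img: "Pin n \<pi> \<inter> {..s} = \<pi> ` P" by (auto simp: Pin_def P_def)
  have card_eq: "card (Pin n \<pi> \<inter> {..s}) = card P"
    unfolding img using inj by (intro card_image) (auto intro: inj_on_subset)
  have ne: "P \<noteq> {}" using s img by auto
  define a where "a = Min P"
  have a: "a \<in> P" "\<And>i. i \<in> P \<Longrightarrow> a \<le> i" using fin ne by (auto simp: a_def)
  define Q where "Q = insert (a - 1) (P \<union> Suc ` P)"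
  have "P \<inter> Suc ` P = {}" by (force simp: P_def)
  then have "card (P \<union> Suc ` P) = 2 * card P"
    using fin by (simp add: card_Un_disjoint card_image)
  moreover have "a - 1 \<notin> P \<union> Suc ` P" using a by (force simp: P_def)
  ultimately have card_Q: "card Q = 2 * card P + 1" using fin by (simp add: Q_def)
  have "\<pi> ` Q \<subseteq> {1..s}"
  proof
    fix x assume "x \<in> \<pi> ` Q"
    then obtain i where i: "i \<in> Q" "x = \<pi> i" by blast
    have "i \<in> {1..n}" using i(1) a(1) by (auto simp: Q_def P_def)
    then have "1 \<le> \<pi> i" using permutes_in_image[OF perm, of i] by auto
    moreover have "\<pi> i \<le> s" using i(1) a(1) by (auto simp: Q_def P_def)
    ultimately show "x \<in> {1..s}" using i by simp
  qed
  then have "card (\<pi> ` Q) \<le> s" using card_mono[of "{1..s}" "\<pi> ` Q"] by simp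
  moreover have "card (\<pi> ` Q) = card Q"
    using inj by (intro card_image) (auto intro: inj_on_subset)
  ultimately show ?thesis using card_Q card_eq by simp
qed

section \<open>Ranks in the increasing enumeration of a finite set\<close>

lemma card_less_nth_sorted_list_of_set:
  fixes A :: "'a::linorder set"
  assumes "finite A" "i < card A"
  shows "card {x \<in> A. x < sorted_list_of_set A ! i} = i"
proof -
  define L where "L = sorted_list_of_set A"
  have L: "sorted_wrt (<) L" "set L = A" "length L = card A"
    using assms by (auto simp: L_def)
  have "{x \<in> A. x < L ! i} = (!) L ` {..<i}"
  proof (intro equalityI subsetI)
    fix x assume x: "x \<in> {x \<in> A. x < L ! i}"
    then obtain k where k: "k < length L" "x = L ! k" using L by (metis (lifting) in_set_conv_nth mem_Collect_eq)
    have "k < i"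
    proof (rule ccontr)
      assume "\<not> k < i"
      then have "L ! i \<le> L ! k" using L(1) k(1)
        by (metis le_neq_implies_less linorder_not_less order.strict_implies_order order_refl sorted_wrt_nth_less)
      then show False using x k by auto
    qed
    then show "x \<in> (!) L ` {..<i}" using k by auto
  next
    fix x assume "x \<in> (!) L ` {..<i}"
    then show "x \<in> {x \<in> A. x < L ! i}"
      using L assms(2) sorted_wrt_nth_less[OF L(1)] by (auto dest: nth_mem)
  qed
  moreover have "inj_on ((!) L) {..<i}"
    using assms by (intro inj_on_nth) (auto simp: L_def)
  ultimately show ?thesis by (simp add: L_def card_image)
qed

text \<open>Otherwise every element below \<open>b\<close> would lie below the entry of index
  \<open>i\<close>, and only \<open>i\<close> elements do.\<close>

lemma nth_sorted_list_of_set_less: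
  fixes A :: "'a::linorder set"
  assumes "finite A" "i < card {x \<in> A. x < b}"
  shows "sorted_list_of_set A ! i < b"
proof (rule ccontr)
  assume "\<not> ?thesis"
  then have "{x \<in> A. x < b} \<subseteq> {x \<in> A. x < sorted_list_of_set A ! i}" by auto
  then have "card {x \<in> A. x < b} \<le> card {x \<in> A. x < sorted_list_of_set A ! i}"
    using assms(1) by (intro card_mono) auto
  moreover have "card {x \<in> A. x < b} \<le> card A" using assms(1) by (intro card_mono) auto
  ultimately show False using card_less_nth_sorted_list_of_set[of A i] assms by simp
qed

section \<open>Sufficiency: the zigzag permutation\<close>

lemma zigzag_permutation:
  assumes sub: "S \<subseteq> {1..m}" and bound: "\<And>s. s \<in> S \<Longrightarrow> 2 * card (S \<inter> {..s}) < s"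
  shows "\<exists>\<pi>. \<pi> permutes {1..m} \<and> S = Pin m \<pi>"
proof -
  define d where "d = card S"
  define s where "s j = sorted_list_of_set S ! j" for j
  define c where "c j = sorted_list_of_set ({1..m} - S) ! j" for j
  \<comment> \<open>With indices from 0, position \<open>2 * j + 1\<close> holds \<open>c j\<close>
    and position \<open>2 * j + 2\<close> holds \<open>s j\<close>; from position
    \<open>2 * d + 1\<close> on, the remaining \<open>c d\<close>, \<open>c (d + 1)\<close>, ...
    follow. Outside \<open>{1..m}\<close> the map is the identity, as \<open>permutes\<close>
    demands.\<close>
  define \<pi> where "\<pi> i = (if i = 0 \<or> m < i then i
      else if 2 * d < i then c (i - 1 - d)
      else if even i then s (i div 2 - 1) else c (i div 2))" for i
  have fin: "finite S" using sub finite_subset by auto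
  have card_C: "card ({1..m} - S) = m - d" using sub fin by (simp add: card_Diff_subset d_def)
  have "d \<le> m" using card_mono[OF _ sub] by (simp add: d_def)
  have s_in: "s j \<in> S" if "j < d" for j
    using that fin nth_mem[of j "sorted_list_of_set S"] by (simp add: s_def d_def)
  have s_ex: "\<exists>j<d. x = s j" if "x \<in> S" for x
    using that fin in_set_conv_nth[of x "sorted_list_of_set S"] by (auto simp: s_def d_def)
  have c_ex: "\<exists>j<m - d. x = c j" if "x \<in> {1..m} - S" for x
    using that in_set_conv_nth[of x "sorted_list_of_set ({1..m} - S)"] card_C by (auto simp: c_def)
  have c_mono: "c i < c j" if "i < j" "j < m - d" for i j
    unfolding c_def using that card_C
    by (intro sorted_wrt_nth_less[OF strict_sorted_list_of_set]) auto
  have s_bound: "2 * (j + 1) < s j" if "j < d" for j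
  proof -
    have "S \<inter> {..s j} = insert (s j) {x \<in> S. x < s j}" using s_in[OF that] by auto
    then have "card (S \<inter> {..s j}) = j + 1"
      using card_less_nth_sorted_list_of_set[OF fin, of j] that fin by (simp add: s_def d_def)
    then show ?thesis using bound[OF s_in[OF that]] by simp
  qed
  have s_le: "s j \<le> m" if "j < d" for j using s_in[OF that] sub by auto
  \<comment> \<open>Exactly \<open>j\<close> of the \<open>s j - 1\<close> positive numbers below
    \<open>s j\<close> lie in \<open>S\<close>; by \<open>s_bound\<close> at least
    \<open>j + 2\<close> non-elements remain there, so \<open>c (j + 1)\<close> is one of
    them.\<close>
  have c_less_s: "c (j + 1) < s j" if "j < d" for j
    unfolding c_def
  proof (rule nth_sorted_list_of_set_less)
    have "{x \<in> S. x < s j} \<subseteq> {1..<s j}" using sub by auto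
    moreover have "{x \<in> {1..m} - S. x < s j} = {1..<s j} - {x \<in> S. x < s j}"
      using s_le[OF that] by auto
    ultimately have "card {x \<in> {1..m} - S. x < s j} = s j - 1 - j"
      using card_less_nth_sorted_list_of_set[OF fin, of j] that fin
      by (simp add: card_Diff_subset s_def d_def)
    then show "j + 1 < card {x \<in> {1..m} - S. x < s j}" using s_bound[OF that] by simp
  qed simp
  have room: "2 * j + 3 \<le> m" if "j < d" for j using s_bound[OF that] s_le[OF that] by simp
  have room_d: "2 * d < m" if "d > 0" using room[of "d - 1"] that by simp
  have \<pi>_s: "\<pi> (2 * j + 2) = s j" if "j < d" for j
    using that room[OF that] by (simp add: \<pi>_def)
  have \<pi>_c: "\<pi> (2 * j + 1) = c j" if "j \<le> d" "2 * j < m" for j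
    using that by (cases "j = d") (auto simp: \<pi>_def)
  have \<pi>_tail: "\<pi> (j + d + 1) = c j" if "d \<le> j" "j < m - d" for j
    using that by (auto simp: \<pi>_def)
  \<comment> \<open>On a finite set surjectivity forces injectivity, so a preimage for each value is
    enough.\<close>
  have surj: "{1..m} \<subseteq> \<pi> ` {1..m}"
  proof
    fix x assume x: "x \<in> {1..m}"
    show "x \<in> \<pi> ` {1..m}"
    proof (cases "x \<in> S")
      case True
      then obtain j where "j < d" "x = s j" using s_ex by blast
      then show ?thesis using \<pi>_s room[of j] by (intro image_eqI[of _ _ "2 * j + 2"]) auto
    next
      case False
      then obtain j where j: "j < m - d" "x = c j" using c_ex x by blast
      show ?thesis
      proof (cases "j < d")
        case True
        then show ?thesis using \<pi>_c j room[of j] by (intro image_eqI[of _ _ "2 * j + 1"]) auto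
      next
        case False
        then show ?thesis using \<pi>_tail j by (intro image_eqI[of _ _ "j + d + 1"]) auto
      qed
    qed
  qed
  then have inj: "inj_on \<pi> {1..m}" by (intro finite_surj_inj) auto
  then have "\<pi> ` {1..m} = {1..m}"
    using surj card_image[OF inj] by (metis card_subset_eq finite_atLeastAtMost finite_imageI)
  then have "\<pi> permutes {1..m}"
    using inj by (intro bij_imp_permutes) (auto simp: bij_betw_def \<pi>_def)
  moreover have "S = Pin m \<pi>"
  proof (intro equalityI subsetI)
    fix x assume "x \<in> S"
    then obtain j where j: "j < d" "x = s j" using s_ex by blast
    note r = room[OF j(1)]
    have "\<pi> (2 * j + 2 - 1) = c j" using \<pi>_c[of j] j r by simp
    moreover have "\<pi> (2 * j + 2 + 1) = c (j + 1)" using \<pi>_c[of "j + 1"] j r by simp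
    moreover have "c j < c (j + 1)" using j r room_d by (intro c_mono) auto
    ultimately show "x \<in> Pin m \<pi>"
      unfolding Pin_def using j r \<pi>_s[OF j(1)] c_less_s[OF j(1)]
      by (intro CollectI exI[of _ "2 * j + 2"]) auto
  next
    fix x assume "x \<in> Pin m \<pi>"
    then obtain i where i: "x = \<pi> i" "2 \<le> i" "i \<le> m - 1" "\<pi> (i - 1) < \<pi> i" "\<pi> i > \<pi> (i + 1)"
      by (auto simp: Pin_def)
    \<comment> \<open>Past position \<open>2 * d\<close> the right neighbour is larger, so there is
      no peak. Even positions up to \<open>2 * d\<close> hold elements of \<open>S\<close>. An odd
      position directly after some \<open>s j\<close> has a larger left neighbour.\<close>
    consider (tail) "2 * d < i" | (even) j where "i = 2 * j + 2" "j < d"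
      | (odd) j where "i = 2 * (j + 1) + 1" "j < d"
    proof (cases "2 * d < i")
      case False
      show ?thesis
      proof (cases "even i")
        case True
        then obtain k where "i = 2 * k" by blast
        then show ?thesis using that(2)[of "k - 1"] i False by auto
      next
        case odd: False
        then obtain k where "i = 2 * k + 1" using oddE by blast
        then show ?thesis using that(3)[of "k - 1"] i False by auto
      qed
    qed (rule that)
    then show "x \<in> S"
    proof cases
      case tail
      have "\<pi> i = c (i - 1 - d)" using \<pi>_tail[of "i - 1 - d"] tail i by simp
      moreover have "\<pi> (i + 1) = c (i - d)" using \<pi>_tail[of "i - d"] tail i by simp
      moreover have "c (i - 1 - d) < c (i - d)" using tail i by (intro c_mono) auto
      ultimately show ?thesis using i by simp
    next
      case even
      then show ?thesis using \<pi>_s s_in i by simp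
    next
      case odd
      have "\<pi> i = c (j + 1)" using \<pi>_c[of "j + 1"] odd i by simp
      moreover have "\<pi> (i - 1) = s j" using \<pi>_s[of j] odd by simp
      ultimately show ?thesis using c_less_s[OF odd(2)] i by simp
    qed
  qed
  ultimately show ?thesis by blast
qed

lemma admissible_iff:
  "admissible S \<longleftrightarrow> finite S \<and> (\<forall>s\<in>S. 2 * card (S \<inter> {..s}) < s)"
proof
  assume "admissible S"
  then obtain n \<pi> where "\<pi> permutes {1..n}" "S = Pin n \<pi>" by (auto simp: admissible_def)
  then show "finite S \<and> (\<forall>s\<in>S. 2 * card (S \<inter> {..s}) < s)"
    using Pin_subset card_Pin_le finite_subset by blast
next
  assume S: "finite S \<and> (\<forall>s\<in>S. 2 * card (S \<inter> {..s}) < s)"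
  \<comment> \<open>The bound makes every element positive. For empty \<open>S\<close> any value of
    \<open>Max {}\<close> will do.\<close>
  then have "S \<subseteq> {1..Max S}" by (auto simp: Suc_le_eq intro: gr_zeroI)
  then show "admissible S" using zigzag_permutation[of S "Max S"] S by (auto simp: admissible_def)
qed

text \<open>The count changes only at elements of \<open>T\<close>, so the bound at the last element
  up to \<open>i\<close> carries over to \<open>i\<close>; before the first element the count is
  0.\<close>

lemma prefix_bound_iff:
  assumes "T \<subseteq> {1..N}"
  shows "(\<forall>i\<in>{1..N}. 2 * card (T \<inter> {..i}) < i) \<longleftrightarrow> (\<forall>t\<in>T. 2 * card (T \<inter> {..t}) < t)"
proof
  assume *: "\<forall>t\<in>T. 2 * card (T \<inter> {..t}) < t"
  show "\<forall>i\<in>{1..N}. 2 * card (T \<inter> {..i}) < i"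
  proof
    fix i assume i: "i \<in> {1..N}"
    show "2 * card (T \<inter> {..i}) < i"
    proof (cases "T \<inter> {..i} = {}")
      case True
      then show ?thesis using i by simp
    next
      case False
      define t where "t = Max (T \<inter> {..i})"
      have t: "t \<in> T" "t \<le> i" using False Max_in[of "T \<inter> {..i}"] by (auto simp: t_def)
      have "T \<inter> {..i} = T \<inter> {..t}" using t by (auto simp: t_def)
      then show ?thesis using * t by (metis order.strict_trans2)
    qed
  qed
qed (use assms in blast)

section \<open>Ballot sequences encoded by their \<open>Y\<close>-positions\<close>

lemma Y_positions_subset: "Y_positions \<beta> \<subseteq> {1..length \<beta>}"
  by (auto simp: Y_positions_def)

lemma count_list_X_Y: "count_list \<beta> X + count_list \<beta> Y = length \<beta>"
proof (induction \<beta>)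
  case (Cons a \<beta>)
  then show ?case by (cases a) auto
qed simp

lemma count_list_Y: "count_list \<beta> Y = card (Y_positions \<beta>)"
proof -
  have "Y_positions \<beta> = Suc ` {i. i < length \<beta> \<and> \<beta> ! i = Y}"
    by (auto simp: Y_positions_def image_iff Suc_le_eq gr0_conv_Suc)
  then show ?thesis
    by (simp add: card_image count_list_eq_length_filter length_filter_conv_card eq_commute)
qed

lemma Y_positions_take:
  assumes "i \<le> length \<beta>"
  shows "Y_positions (take i \<beta>) = Y_positions \<beta> \<inter> {..i}"
  using assms by (auto simp: Y_positions_def)

text \<open>The two letters exhaust a prefix of length \<open>i\<close>, so \<open>X\<close> is in
  the majority iff twice the number of \<open>Y\<close>s is below \<open>i\<close>. This gives the
  ballot condition the shape of \<open>admissible_iff\<close>.\<close>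

lemma ballot_sequences_iff:
  "\<beta> \<in> ballot_sequences p q \<longleftrightarrow> length \<beta> = p + q \<and> card (Y_positions \<beta>) = q \<and>
     (\<forall>t\<in>Y_positions \<beta>. 2 * card (Y_positions \<beta> \<inter> {..t}) < t)"
proof (cases "length \<beta> = p + q")
  case True
  have "count_list (take i \<beta>) Y < count_list (take i \<beta>) X \<longleftrightarrow> 2 * card (Y_positions \<beta> \<inter> {..i}) < i"
    if "i \<in> {1..p + q}" for i
    using that True count_list_X_Y[of "take i \<beta>"] Y_positions_take[of i \<beta>]
    by (auto simp: count_list_Y)
  moreover have "count_list \<beta> X = p" if "card (Y_positions \<beta>) = q"
    using that True count_list_X_Y[of \<beta>] by (simp add: count_list_Y)
  ultimately show ?thesis
    using True prefix_bound_iff[OF Y_positions_subset[of \<beta>]]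
    by (auto simp: ballot_sequences_def count_list_Y)
qed (auto simp: ballot_sequences_def)

lemma Y_positions_inject:
  assumes "length \<beta> = length \<gamma>" "Y_positions \<beta> = Y_positions \<gamma>"
  shows "\<beta> = \<gamma>"
proof (rule nth_equalityI)
  fix i assume i: "i < length \<beta>"
  have "Suc i \<in> Y_positions \<beta> \<longleftrightarrow> Suc i \<in> Y_positions \<gamma>" using assms(2) by simp
  then have "\<beta> ! i = Y \<longleftrightarrow> \<gamma> ! i = Y" using i assms(1) by (simp add: Y_positions_def)
  then show "\<beta> ! i = \<gamma> ! i" by (metis letter.exhaust)
qed fact

section \<open>The bijection\<close>

text \<open>Adjoining \<open>m\<close> leaves the criterion at smaller elements unchanged, and at
  \<open>m\<close> itself it reads \<open>2 * d < m\<close>.\<close>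

lemma pinnacle_sets_insert_iff:
  assumes T: "T \<subseteq> {1..<m}" and "2 * d < m" "d > 0"
  shows "insert m T \<in> pinnacle_sets m d \<longleftrightarrow>
    card T = d - 1 \<and> (\<forall>t\<in>T. 2 * card (T \<inter> {..t}) < t)"
proof -
  have fin: "finite T" using T finite_subset by auto
  have "m \<notin> T" using T by auto
  then have card: "card (insert m T) = Suc (card T)" using fin by simp
  have "Max (insert m T) = m" using fin T by (intro Max_eqI) auto
  moreover have "insert m T \<inter> {..t} = T \<inter> {..t}" if "t \<in> T" for t using that T by auto
  moreover have "insert m T \<inter> {..m} = insert m T" using T by auto
  ultimately show ?thesis
    using card fin assms(2,3) by (auto simp: pinnacle_sets_def admissible_iff)
qed

theorem theorem3p4:
  fixes m d :: nat
  assumes "m > 0" and "d > 0" and "m > 2 * d"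
  shows "(\<forall>\<beta>\<in>ballot_sequences (m - d) (d - 1). length \<beta> = m - 1 \<and> Y_positions \<beta> \<inter> {m} = {}) \<and>
         bij_betw (eta m) (ballot_sequences (m - d) (d - 1)) (pinnacle_sets m d)"
proof -
  let ?B = "ballot_sequences (m - d) (d - 1)"
  have len: "length \<beta> = m - 1" if "\<beta> \<in> ?B" for \<beta>
    using that assms by (auto simp: ballot_sequences_iff)
  have sub: "Y_positions \<beta> \<subseteq> {1..<m}" if "length \<beta> = m - 1" for \<beta>
    using that assms Y_positions_subset[of \<beta>] by (fastforce dest: subsetD)
  \<comment> \<open>One direction shows that \<open>eta m\<close> maps into the target; the other
    shows that the preimage built below is a ballot sequence.\<close>
  have mem_iff: "eta m \<beta> \<in> pinnacle_sets m d \<longleftrightarrow> \<beta> \<in> ?B" if "length \<beta> = m - 1" for \<beta>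
    using pinnacle_sets_insert_iff[OF sub[OF that]] that assms
    by (auto simp: eta_def ballot_sequences_iff)
  have "inj_on (eta m) ?B"
  proof (rule inj_onI)
    fix \<beta> \<gamma> assume "\<beta> \<in> ?B" "\<gamma> \<in> ?B" and eq: "eta m \<beta> = eta m \<gamma>"
    then have l: "length \<beta> = m - 1" "length \<gamma> = m - 1" using len by auto
    have "m \<notin> Y_positions \<beta>" "m \<notin> Y_positions \<gamma>" using l[THEN sub] by auto
    then have "Y_positions \<beta> = Y_positions \<gamma>" using eq by (auto simp: eta_def)
    then show "\<beta> = \<gamma>" using l by (intro Y_positions_inject) auto
  qed
  moreover have "eta m ` ?B = pinnacle_sets m d"
  proof (intro equalityI subsetI)
    fix S assume S: "S \<in> pinnacle_sets m d"
    then have "finite S" "\<forall>s\<in>S. 0 < s" "Max S = m" "S \<noteq> {}"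
      by (auto simp: pinnacle_sets_def admissible_iff intro: gr_zeroI)
    then have "S \<subseteq> {1..m}" "m \<in> S" using Max_in[of S] by (auto simp: Suc_le_eq)
    \<comment> \<open>The letter \<open>Y\<close> marks the elements of \<open>S\<close> below
      \<open>m\<close>; \<open>eta\<close> puts \<open>m\<close> back.\<close>
    define \<beta> where "\<beta> = map (\<lambda>i. if i \<in> S then Y else X) [1..<m]"
    have l: "length \<beta> = m - 1" by (simp add: \<beta>_def)
    have "Y_positions \<beta> = S \<inter> {1..<m}" by (auto simp: Y_positions_def \<beta>_def split: if_splits)
    then have "eta m \<beta> = S" using \<open>S \<subseteq> {1..m}\<close> \<open>m \<in> S\<close> by (force simp: eta_def)
    then show "S \<in> eta m ` ?B" using mem_iff[OF l] S by blast
  qed (use mem_iff len in auto)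
  ultimately show ?thesis using len sub by (fastforce simp: bij_betw_def)
qed

end
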